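(* Consider the diagonal system ($m=2$) $$\partial_tQ_1+\lambda_1(Q_1,Q_2)\,\partial_xQ_1=0,\qquad \partial_tQ_2+\lambda_2(Q_1,Q_2)\,\partial_xQ_2=0$$ with smooth $\lambda_1,\lambda_2:\mathbb R^2\to\mathbb R$ and smooth initial data $Q_{i,0}(x)=Q_i(0,x)$, $i=1,2$, for which a smooth solution exists for small times. Let $\alpha\in(0,1]$ and fix $x\in\mathbb R$. For $t\ge0$ define the predictor step $$\hat\xi_1^*:=x-\alpha t\,\lambda_1(Q_{1,0}(x),Q_{2,0}(x)),\qquad \hat\xi_2^*:=x-\alpha t\,\lambda_2(Q_{1,0}(x),Q_{2,0}(x)),$$ then $$\lambda_1^*:=\lambda_1\Big(Q_{1,0}\big(\hat\xi_1^*-\alpha t\,\lambda_1(Q_{1,0}(\hat\xi_1^* ),Q_{2,0}(\hat\xi_1^* ))\big),\;Q_{2,0}\big(\hat\xi_1^*-\alpha t\,\lambda_2(Q_{1,0}(\hat\xi_1^* ),Q_{2,0}(\hat\xi_1^* ))\big)\Big),$$ $$\lambda_2^*:=\lambda_2\Big(Q_{1,0}\big(\hat\xi_2^*-\alpha t\,\lambda_1(Q_{1,0}(\hat\xi_2^* ),Q_{2,0}(\hat\xi_2^* ))\big),\;Q_{2,0}\big(\hat\xi_2^*-\alpha t\,\lambda_2(Q_{1,0}(\hat\xi_2^* ),Q_{2,0}(\hat\xi_2^* ))\big)\Big),$$ and $$\hat\xi_1:=x-t\Big(1-\frac1{2\alpha}\Big)\lambda_1(Q_{1,0}(x),Q_{2,0}(x))-t\,\frac1{2\alpha}\lambda_1^*,$$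 $$\hat\xi_2:=x-t\Big(1-\frac1{2\alpha}\Big)\lambda_2(Q_{1,0}(x),Q_{2,0}(x))-t\,\frac1{2\alpha}\lambda_2^*.$$ Then $Q_{1,0}(\hat\xi_1),Q_{2,0}(\hat\xi_2)$ approximate $Q_1(t,x),Q_2(t,x)$ with an error $\mathcal O(t^3)$, i.e. $Q_{i,0}(\hat\xi_i)=Q_i(t,x)+\mathcal O(t^3)$ as $t\to0^+$ for $i=1,2$, for any $\alpha\in(0,1]$.
   Context: The system is a nonlinear hyperbolic system of two conservation laws in one space dimension, rewritten (in the absence of shocks) in characteristic variables $Q=(Q_1,Q_2)$; $\lambda_1,\lambda_2$ are the characteristic speeds. "Exact solution" means the smooth solution $Q=(Q_1,Q_2)$ of the initial value problem. *)

theory Defs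
  imports "HOL-Analysis.Analysis" "HOL-Library.Landau_Symbols"
begin

(* Derivatives are taken within S, so that on a half-closed strip such as {0..<T} \<times> UNIV they are
   one-sided at the initial time.  The notion is meaningful for sets on which the derivative within
   S is unique (open sets, and convex sets with nonempty interior); only such sets are used. *)
primrec Ck_on :: "nat \<Rightarrow> 'a set \<Rightarrow> ('a::real_normed_vector \<Rightarrow> 'b::real_normed_vector) \<Rightarrow> bool" where
  "Ck_on 0 S f \<longleftrightarrow> continuous_on S f"
| "Ck_on (Suc k) S f \<longleftrightarrow>
     f differentiable_on S \<and> (\<forall>v. Ck_on k S (\<lambda>x. frechet_derivative f (at x within S) v))"

definition smooth_on :: "'a set \<Rightarrow> ('a::real_normed_vector \<Rightarrow> 'b::real_normed_vector) \<Rightarrow> bool" where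
  "smooth_on S f \<longleftrightarrow> (\<forall>k. Ck_on k S f)"

(* q, as a function of (t, x), satisfies  q_t + c(t, x) q_x = 0  on [0, T) x R. *)
definition solves_transport :: "real \<Rightarrow> (real \<times> real \<Rightarrow> real) \<Rightarrow> (real \<times> real \<Rightarrow> real) \<Rightarrow> bool" where
  "solves_transport T c q \<longleftrightarrow>
     (\<forall>t\<in>{0..<T}. \<forall>x. \<exists>qt qx.
        ((\<lambda>s. q (s, x)) has_real_derivative qt) (at t within {0..<T}) \<and>
        ((\<lambda>y. q (t, y)) has_real_derivative qx) (at x) \<and>
        qt + c (t, x) * qx = 0)"

definition smooth_diagonal_solution ::
  "(real \<times> real \<Rightarrow> real) \<Rightarrow> (real \<times> real \<Rightarrow> real) \<Rightarrow> (real \<Rightarrow> real) \<Rightarrow> (real \<Rightarrow> real) \<Rightarrow> real \<Rightarrow>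
   (real \<times> real \<Rightarrow> real) \<Rightarrow> (real \<times> real \<Rightarrow> real) \<Rightarrow> bool" where
  "smooth_diagonal_solution l1 l2 Q10 Q20 T Q1 Q2 \<longleftrightarrow>
     smooth_on ({0..<T} \<times> UNIV) Q1 \<and> smooth_on ({0..<T} \<times> UNIV) Q2 \<and>
     (\<forall>x. Q1 (0, x) = Q10 x) \<and> (\<forall>x. Q2 (0, x) = Q20 x) \<and>
     solves_transport T (\<lambda>p. l1 (Q1 p, Q2 p)) Q1 \<and>
     solves_transport T (\<lambda>p. l2 (Q1 p, Q2 p)) Q2"

(* In the following, l is the speed of the family under consideration (l1 or l2) and s is the time
   step; with s = \<alpha> * t, euler_foot l Q10 Q20 s x is the predictor \<xi>\<^sup>* of that family. *)
definition euler_foot ::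
  "(real \<times> real \<Rightarrow> real) \<Rightarrow> (real \<Rightarrow> real) \<Rightarrow> (real \<Rightarrow> real) \<Rightarrow> real \<Rightarrow> real \<Rightarrow> real" where
  "euler_foot l Q10 Q20 s x = x - s * l (Q10 x, Q20 x)"

definition predicted_speed ::
  "(real \<times> real \<Rightarrow> real) \<Rightarrow> (real \<times> real \<Rightarrow> real) \<Rightarrow> (real \<times> real \<Rightarrow> real) \<Rightarrow>
   (real \<Rightarrow> real) \<Rightarrow> (real \<Rightarrow> real) \<Rightarrow> real \<Rightarrow> real \<Rightarrow> real" where
  "predicted_speed l1 l2 l Q10 Q20 s x =
     (let y = euler_foot l Q10 Q20 s x
      in l (Q10 (euler_foot l1 Q10 Q20 s y), Q20 (euler_foot l2 Q10 Q20 s y)))"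

definition corrected_foot ::
  "(real \<times> real \<Rightarrow> real) \<Rightarrow> (real \<times> real \<Rightarrow> real) \<Rightarrow> (real \<times> real \<Rightarrow> real) \<Rightarrow>
   (real \<Rightarrow> real) \<Rightarrow> (real \<Rightarrow> real) \<Rightarrow> real \<Rightarrow> real \<Rightarrow> real \<Rightarrow> real" where
  "corrected_foot l1 l2 l Q10 Q20 \<alpha> t x =
     x - t * (1 - 1 / (2 * \<alpha>)) * l (Q10 x, Q20 x)
       - t * (1 / (2 * \<alpha>)) * predicted_speed l1 l2 l Q10 Q20 (\<alpha> * t) x"

end

theory Submission
  imports Defs
begin

text \<open>
  Each component of the solution is transported, \<open>q\<^sub>t + c q\<^sub>x = 0\<close> with \<open>c = l (Q1, Q2)\<close>, so it
  would be constant along its characteristic. The proof measures how far it is from being constant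
  along a straight line. Join a foot \<open>(0, x - t w)\<close> to \<open>(t, x)\<close> by the segment with speed \<open>w\<close>. Along it
  \<open>q\<close> has derivative \<open>(w - c) q\<^sub>x\<close>. With \<open>c\<close> linearised at \<open>(0, x)\<close> and
  \<open>\<lambda> = c (0, x)\<close>, the speed error \<open>w - c\<close> at time \<open>s\<close> is
  \<open>(w - \<lambda> - t/2 (c\<^sub>t - \<lambda> c\<^sub>x)) + (t/2 - s) (c\<^sub>t + \<lambda> c\<^sub>x)\<close>
  up to \<open>O(t\<^sup>2)\<close>. The second term has integral zero over \<open>[0, t]\<close>. Hence the foot is correct to third
  order as soon as \<open>w(t) = \<lambda> + t/2 (c\<^sub>t - \<lambda> c\<^sub>x) + O(t\<^sup>2)\<close>; this is
  \<open>transport_straight_line_order_3\<close>. Only first derivatives of the speed and of \<open>q\<close> appear, so no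
  mixed second derivatives have to be compared and no characteristic has to be constructed.

  It remains to check that the corrected speed has this slope at \<open>t = 0\<close>. In the predicted speed with step
  \<open>s\<close>, the argument of \<open>Q\<^sub>i\<close> at time zero is \<open>x - s (\<lambda> + \<lambda>\<^sub>i) + O(s\<^sup>2)\<close>: one Euler step with the family's
  own speed, then one with the speed of \<open>Q\<^sub>i\<close> (\<open>predicted_speed_has_quadratic_expansion\<close>). Moving by
  \<open>-s \<lambda>\<^sub>i\<close> in space changes \<open>Q\<^sub>i\<close> to first order as moving by \<open>s\<close> in time does, by the equation for
  \<open>Q\<^sub>i\<close>. So the slope of the predicted speed in \<open>s\<close> is \<open>c\<^sub>t - \<lambda> c\<^sub>x\<close>, and with \<open>s = \<alpha> t\<close> the weight
  \<open>1/(2\<alpha>)\<close> turns it into the required \<open>(c\<^sub>t - \<lambda> c\<^sub>x)/2\<close>, whatever \<open>\<alpha>\<close> is.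
\<close>

section \<open>Linearisation with quadratic remainder\<close>

text \<open>
  Differentiability at \<open>a\<close> gives only a remainder \<open>o(\<bar>z - a\<bar>)\<close>, which would lose the order of the scheme.
  The quadratic remainder is what \<open>C\<^sup>2\<close> functions have. It is preserved by composition
  and by products, so the expansions of the scheme can be computed with
  linear maps alone, never with second derivatives.
\<close>
definition has_quadratic_expansion ::
  "('a::real_normed_vector \<Rightarrow> 'b::real_normed_vector) \<Rightarrow> ('a \<Rightarrow> 'b) \<Rightarrow> 'a \<Rightarrow> 'a set \<Rightarrow> bool" where
  "has_quadratic_expansion f A a S \<longleftrightarrow> bounded_linear A \<and>
     (\<exists>C d. 0 < d \<and> (\<forall>z\<in>S. norm (z - a) < d \<longrightarrow> norm (f z - f a - A (z - a)) \<le> C * (norm (z - a))\<^sup>2))"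

lemma has_quadratic_expansionI:
  assumes "bounded_linear A" "0 < d"
    and "\<And>z. z \<in> S \<Longrightarrow> norm (z - a) < d \<Longrightarrow> norm (f z - f a - A (z - a)) \<le> C * (norm (z - a))\<^sup>2"
  shows "has_quadratic_expansion f A a S"
  using assms unfolding has_quadratic_expansion_def by blast

lemma has_quadratic_expansion_bounded_linear:
  "has_quadratic_expansion f A a S \<Longrightarrow> bounded_linear A"
  by (simp add: has_quadratic_expansion_def)

lemma has_quadratic_expansionE:
  assumes "has_quadratic_expansion f A a S"
  obtains C d where "0 \<le> C" "0 < d" "d \<le> 1"
    "\<And>z. z \<in> S \<Longrightarrow> norm (z - a) < d \<Longrightarrow> norm (f z - f a - A (z - a)) \<le> C * (norm (z - a))\<^sup>2"
proof -
  obtain C d where d: "0 < d"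
    and C: "\<And>z. z \<in> S \<Longrightarrow> norm (z - a) < d \<Longrightarrow> norm (f z - f a - A (z - a)) \<le> C * (norm (z - a))\<^sup>2"
    using assms unfolding has_quadratic_expansion_def by blast
  have "norm (f z - f a - A (z - a)) \<le> \<bar>C\<bar> * (norm (z - a))\<^sup>2"
    if "z \<in> S" "norm (z - a) < min d 1" for z
    using C[of z] that by (smt (verit) mult_right_mono zero_le_power2)
  then show thesis
    using that[of "\<bar>C\<bar>" "min d 1"] d by auto
qed

lemma has_quadratic_expansion_const: "has_quadratic_expansion (\<lambda>z. c) (\<lambda>h. 0) a S"
  by (rule has_quadratic_expansionI[where d = 1 and C = 0]) auto

lemma has_quadratic_expansion_linear:
  assumes "bounded_linear A"
  shows "has_quadratic_expansion A A a S"
  using assms by (intro has_quadratic_expansionI[where d = 1 and C = 0]) (auto simp: linear_simps)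

lemma has_quadratic_expansion_Pair:
  assumes f: "has_quadratic_expansion f A a S" and g: "has_quadratic_expansion g B a S"
  shows "has_quadratic_expansion (\<lambda>z. (f z, g z)) (\<lambda>h. (A h, B h)) a S"
proof -
  obtain C d where d: "0 < d" and C:
    "\<And>z. z \<in> S \<Longrightarrow> norm (z - a) < d \<Longrightarrow> norm (f z - f a - A (z - a)) \<le> C * (norm (z - a))\<^sup>2"
    using has_quadratic_expansionE[OF f] by metis
  obtain C' d' where d': "0 < d'" and C':
    "\<And>z. z \<in> S \<Longrightarrow> norm (z - a) < d' \<Longrightarrow> norm (g z - g a - B (z - a)) \<le> C' * (norm (z - a))\<^sup>2"
    using has_quadratic_expansionE[OF g] by metis
  show ?thesis
  proof (rule has_quadratic_expansionI[where d = "min d d'" and C = "C + C'"])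
    show "bounded_linear (\<lambda>h. (A h, B h))"
      using f g by (intro bounded_linear_Pair has_quadratic_expansion_bounded_linear)
    fix z assume z: "z \<in> S" "norm (z - a) < min d d'"
    have "norm ((f z, g z) - (f a, g a) - (A (z - a), B (z - a)))
        \<le> norm (f z - f a - A (z - a)) + norm (g z - g a - B (z - a))"
      using norm_Pair_le by simp
    also have "\<dots> \<le> (C + C') * (norm (z - a))\<^sup>2"
      using C[of z] C'[of z] z by (simp add: distrib_right)
    finally show "norm ((f z, g z) - (f a, g a) - (A (z - a), B (z - a))) \<le> (C + C') * (norm (z - a))\<^sup>2" .
  qed (use d d' in auto)
qed

lemma has_quadratic_expansion_Lipschitz:
  assumes "has_quadratic_expansion f A a S"
  obtains M d where "0 < M" "0 < d"
    "\<And>z. z \<in> S \<Longrightarrow> norm (z - a) < d \<Longrightarrow> norm (f z - f a) \<le> M * norm (z - a)"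
proof -
  obtain C d where C0: "0 \<le> C" and d: "0 < d" "d \<le> 1" and C:
    "\<And>z. z \<in> S \<Longrightarrow> norm (z - a) < d \<Longrightarrow> norm (f z - f a - A (z - a)) \<le> C * (norm (z - a))\<^sup>2"
    using has_quadratic_expansionE[OF assms] by metis
  obtain K where K: "0 < K" "\<And>h. norm (A h) \<le> norm h * K"
    using bounded_linear.pos_bounded[OF has_quadratic_expansion_bounded_linear[OF assms]] by blast
  have "norm (f z - f a) \<le> (K + C) * norm (z - a)" if z: "z \<in> S" "norm (z - a) < d" for z
  proof -
    have "norm (f z - f a) \<le> norm (A (z - a)) + norm (f z - f a - A (z - a))"
      by (metis add.commute diff_add_cancel norm_triangle_ineq)
    also have "\<dots> \<le> norm (z - a) * K + C * (norm (z - a))\<^sup>2"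
      using C[OF z] K(2) by (rule add_mono[rotated])
    also have "C * (norm (z - a))\<^sup>2 \<le> C * norm (z - a)"
      using z d C0 by (intro mult_left_mono) (auto simp: power2_eq_square intro: mult_left_le)
    finally show ?thesis by (simp add: algebra_simps)
  qed
  then show thesis
    using that[of "K + C" d] d K(1) C0 by auto
qed

text \<open>
  The remainder of \<open>g\<close> stays quadratic because \<open>f\<close> is Lipschitz at \<open>a\<close>, and the remainder of \<open>f\<close> because \<open>B\<close> is
  bounded.
\<close>
lemma has_quadratic_expansion_compose:
  assumes f: "has_quadratic_expansion f A a S" and g: "has_quadratic_expansion g B (f a) T"
    and "f ` S \<subseteq> T"
  shows "has_quadratic_expansion (\<lambda>z. g (f z)) (\<lambda>h. B (A h)) a S"
proof -
  obtain C d where C0: "0 \<le> C" and d: "0 < d" "d \<le> 1" and C: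
    "\<And>z. z \<in> S \<Longrightarrow> norm (z - a) < d \<Longrightarrow> norm (f z - f a - A (z - a)) \<le> C * (norm (z - a))\<^sup>2"
    using has_quadratic_expansionE[OF f] by metis
  obtain C' d' where C'0: "0 \<le> C'" and d': "0 < d'" and C':
    "\<And>w. w \<in> T \<Longrightarrow> norm (w - f a) < d' \<Longrightarrow> norm (g w - g (f a) - B (w - f a)) \<le> C' * (norm (w - f a))\<^sup>2"
    using has_quadratic_expansionE[OF g] by metis
  obtain M e where M: "0 < M" and e: "0 < e" and
    lip: "\<And>z. z \<in> S \<Longrightarrow> norm (z - a) < e \<Longrightarrow> norm (f z - f a) \<le> M * norm (z - a)"
    using has_quadratic_expansion_Lipschitz[OF f] by metis
  have B: "bounded_linear B"
    using g by (rule has_quadratic_expansion_bounded_linear)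
  then obtain K where K: "0 < K" "\<And>h. norm (B h) \<le> norm h * K"
    using bounded_linear.pos_bounded by blast
  show ?thesis
  proof (rule has_quadratic_expansionI[where d = "min d (min e (d' / M))" and C = "C' * M\<^sup>2 + C * K"])
    show "bounded_linear (\<lambda>h. B (A h))"
      using bounded_linear_compose[OF B has_quadratic_expansion_bounded_linear[OF f]] by (simp add: o_def)
    fix z assume z: "z \<in> S" "norm (z - a) < min d (min e (d' / M))"
    have l: "norm (f z - f a) \<le> M * norm (z - a)" using lip z by simp
    also have "\<dots> < d'" using z M by (simp add: field_simps)
    finally have "norm (g (f z) - g (f a) - B (f z - f a)) \<le> C' * (norm (f z - f a))\<^sup>2"
      using C' z assms(3) by auto
    also have "\<dots> \<le> C' * (M * norm (z - a))\<^sup>2"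
      using l C'0 by (intro mult_left_mono power_mono) auto
    finally have 1: "norm (g (f z) - g (f a) - B (f z - f a)) \<le> C' * M\<^sup>2 * (norm (z - a))\<^sup>2"
      by (simp add: power_mult_distrib algebra_simps)
    have "norm (B (f z - f a - A (z - a))) \<le> norm (f z - f a - A (z - a)) * K"
      by (rule K)
    also have "\<dots> \<le> C * (norm (z - a))\<^sup>2 * K"
      using C z K by (intro mult_right_mono) auto
    finally have 2: "norm (B (f z - f a - A (z - a))) \<le> C * K * (norm (z - a))\<^sup>2"
      by (simp add: algebra_simps)
    have "g (f z) - g (f a) - B (A (z - a))
        = (g (f z) - g (f a) - B (f z - f a)) + B (f z - f a - A (z - a))"
      using B by (simp add: linear_simps)
    then show "norm (g (f z) - g (f a) - B (A (z - a))) \<le> (C' * M\<^sup>2 + C * K) * (norm (z - a))\<^sup>2"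
      using 1 2 norm_triangle_ineq[of "g (f z) - g (f a) - B (f z - f a)" "B (f z - f a - A (z - a))"]
      by (simp add: algebra_simps)
  qed (use d e d' M in auto)
qed

lemma has_quadratic_expansion_mult:
  fixes f g :: "'a::real_normed_vector \<Rightarrow> real"
  assumes f: "has_quadratic_expansion f A a S" and g: "has_quadratic_expansion g B a S"
  shows "has_quadratic_expansion (\<lambda>z. f z * g z) (\<lambda>h. f a * B h + A h * g a) a S"
proof -
  have "has_quadratic_expansion (\<lambda>p. fst p * snd p) (\<lambda>h. fst p * snd h + fst h * snd p) p UNIV"
    for p :: "real \<times> real"
  proof (rule has_quadratic_expansionI[where d = 1 and C = 1])
    show "bounded_linear (\<lambda>h. fst p * snd h + fst h * snd p)"
      by (intro bounded_linear_intros)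
    fix z :: "real \<times> real"
    have "\<bar>fst (z - p)\<bar> * \<bar>snd (z - p)\<bar> \<le> norm (z - p) * norm (z - p)"
      using norm_fst_le[of "fst (z - p)" "snd (z - p)"] norm_snd_le[of "snd (z - p)" "fst (z - p)"]
      unfolding prod.collapse real_norm_def by (intro mult_mono) auto
    moreover have "fst z * snd z - fst p * snd p - (fst p * snd (z - p) + fst (z - p) * snd p)
        = fst (z - p) * snd (z - p)"
      by (simp add: algebra_simps)
    ultimately show "norm (fst z * snd z - fst p * snd p - (fst p * snd (z - p) + fst (z - p) * snd p))
        \<le> 1 * (norm (z - p))\<^sup>2"
      by (simp add: abs_mult power2_eq_square)
  qed simp
  from has_quadratic_expansion_compose[OF has_quadratic_expansion_Pair[OF f g] this] show ?thesis
    by simp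
qed

lemma has_quadratic_expansion_diff:
  assumes f: "has_quadratic_expansion f A a S" and g: "has_quadratic_expansion g B a S"
  shows "has_quadratic_expansion (\<lambda>z. f z - g z) (\<lambda>h. A h - B h) a S"
  using has_quadratic_expansion_compose[OF has_quadratic_expansion_Pair[OF f g]
      has_quadratic_expansion_linear[of "\<lambda>p. fst p - snd p" _ UNIV]]
  by (simp add: bounded_linear_sub bounded_linear_fst bounded_linear_snd)

text \<open>
  For the derivative of a \<open>C\<^sup>2\<close> function, this pointwise estimate replaces second-order Taylor expansion.
\<close>
lemma differentiable_imp_locally_Lipschitz_at:
  fixes f :: "'a::real_normed_vector \<Rightarrow> 'b::real_normed_vector"
  assumes "f differentiable (at a within S)"
  obtains M d where "0 < M" "0 < d"
    "\<And>z. z \<in> S \<Longrightarrow> norm (z - a) < d \<Longrightarrow> norm (f z - f a) \<le> M * norm (z - a)"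
proof -
  obtain D where D: "(f has_derivative D) (at a within S)"
    using assms unfolding differentiable_def by blast
  then obtain d where d: "0 < d" "\<And>z. z \<in> S \<Longrightarrow> norm (z - a) < d \<Longrightarrow>
      norm (f z - f a - D (z - a)) \<le> 1 * norm (z - a)"
    unfolding has_derivative_within_alt by (metis zero_less_one)
  obtain K where K: "0 < K" "\<And>h. norm (D h) \<le> norm h * K"
    using bounded_linear.pos_bounded[OF has_derivative_bounded_linear[OF D]] by blast
  have "norm (f z - f a) \<le> (K + 1) * norm (z - a)" if "z \<in> S" "norm (z - a) < d" for z
  proof -
    have "norm (f z - f a) \<le> norm (D (z - a)) + norm (f z - f a - D (z - a))"
      by (metis add.commute diff_add_cancel norm_triangle_ineq)
    then show ?thesis using d(2)[OF that] K(2)[of "z - a"] by (simp add: algebra_simps)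
  qed
  then show thesis using that[of "K + 1" d] K d by auto
qed

text \<open>
  Every \<open>z \<mapsto> Df(z) b\<close> is differentiable at \<open>a\<close>, so \<open>\<bar>Df(z) b - Df(a) b\<bar> = O(\<bar>z - a\<bar>)\<close>; summing over the finite
  basis bounds \<open>\<parallel>Df(z) - Df(a)\<parallel>\<close> by \<open>C \<bar>z - a\<bar>\<close>. The mean value inequality for \<open>f - Df(a)\<close> on the convex
  set \<open>S\<close>, cut to the ball of radius \<open>\<bar>z - a\<bar>\<close>, then gives the remainder \<open>C \<bar>z - a\<bar>\<^sup>2\<close>. The argument covers
  boundary points of \<open>S\<close>, such as points at the initial time.
\<close>
lemma Ck_on_has_quadratic_expansion:
  fixes f :: "'a::euclidean_space \<Rightarrow> 'b::real_normed_vector"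
  assumes Ck: "Ck_on (Suc (Suc 0)) S f" and S: "convex S" "a \<in> S"
  shows "has_quadratic_expansion f (frechet_derivative f (at a within S)) a S"
proof -
  let ?D = "\<lambda>z. frechet_derivative f (at z within S)"
  have D: "(f has_derivative ?D z) (at z within S)" if "z \<in> S" for z
    using Ck that by (simp add: differentiable_on_def frechet_derivative_works)
  have lin: "bounded_linear (?D z)" if "z \<in> S" for z
    using has_derivative_bounded_linear[OF D[OF that]] .
  have "(\<lambda>z. ?D z b) differentiable (at a within S)" for b
    using Ck S by (simp add: differentiable_on_def)
  then have "\<forall>b. \<exists>M d. 0 < M \<and> 0 < d \<and>
      (\<forall>z\<in>S. norm (z - a) < d \<longrightarrow> norm (?D z b - ?D a b) \<le> M * norm (z - a))"
    by (metis differentiable_imp_locally_Lipschitz_at)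
  then obtain M d where M: "\<And>b. 0 < M b" and d: "\<And>b. 0 < d b" and
    lip: "\<And>b z. z \<in> S \<Longrightarrow> norm (z - a) < d b \<Longrightarrow> norm (?D z b - ?D a b) \<le> M b * norm (z - a)"
    by metis
  define e where "e = Min (d ` Basis)"
  define C where "C = (\<Sum>b\<in>Basis. M b)"
  have e: "0 < e" "\<And>b. b \<in> Basis \<Longrightarrow> e \<le> d b"
    unfolding e_def using d by (auto simp: Min_gr_iff)
  have C0: "0 \<le> C" unfolding C_def using M by (intro sum_nonneg less_imp_le)
  have op: "norm (?D z v - ?D a v) \<le> C * norm (z - a) * norm v"
    if z: "z \<in> S" "norm (z - a) < e" for z v
  proof -
    have L: "linear (\<lambda>v. ?D z v - ?D a v)"
      using lin z S by (intro linear_compose_sub bounded_linear.linear) auto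
    have "?D z v - ?D a v = (\<Sum>b\<in>Basis. (v \<bullet> b) *\<^sub>R (?D z b - ?D a b))"
      using linear_sum[OF L, of "\<lambda>b. (v \<bullet> b) *\<^sub>R b" Basis] linear_scale[OF L]
      by (simp add: euclidean_representation)
    also have "norm \<dots> \<le> (\<Sum>b\<in>Basis. norm v * (M b * norm (z - a)))"
    proof (rule sum_norm_le)
      fix b :: 'a assume b: "b \<in> Basis"
      have "norm (?D z b - ?D a b) \<le> M b * norm (z - a)" using lip z e(2)[OF b] by simp
      then show "norm ((v \<bullet> b) *\<^sub>R (?D z b - ?D a b)) \<le> norm v * (M b * norm (z - a))"
        using Basis_le_norm[OF b, of v] by (auto intro!: mult_mono)
    qed
    also have "\<dots> = C * norm (z - a) * norm v"
      by (simp add: C_def sum_distrib_left sum_distrib_right mult_ac)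
    finally show ?thesis .
  qed
  show ?thesis
  proof (rule has_quadratic_expansionI[where d = e and C = C])
    show "bounded_linear (?D a)" using lin S by simp
    fix z assume z: "z \<in> S" "norm (z - a) < e"
    let ?r = "norm (z - a)" and ?g = "\<lambda>w. f w - ?D a w"
    have "norm (?g z - ?g a) \<le> C * ?r * norm (z - a)"
    proof (rule differentiable_bound[where f' = "\<lambda>w v. ?D w v - ?D a v" and S = "S \<inter> cball a ?r"])
      show "convex (S \<inter> cball a ?r)" using S by (intro convex_Int) auto
      fix w assume w: "w \<in> S \<inter> cball a ?r"
      then have wr: "norm (w - a) \<le> ?r" by (simp add: dist_norm norm_minus_commute)
      show "(?g has_derivative (\<lambda>v. ?D w v - ?D a v)) (at w within S \<inter> cball a ?r)"
        using w lin[OF S(2)]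
        by (intro has_derivative_diff has_derivative_subset[OF D[of w]] bounded_linear_imp_has_derivative) auto
      show "onorm (\<lambda>v. ?D w v - ?D a v) \<le> C * ?r"
      proof (rule onorm_le)
        fix v
        have "norm (?D w v - ?D a v) \<le> C * norm (w - a) * norm v"
          using op[of w] w wr z by auto
        also have "\<dots> \<le> C * ?r * norm v"
          using wr C0 by (intro mult_right_mono mult_left_mono) auto
        finally show "norm (?D w v - ?D a v) \<le> C * ?r * norm v" .
      qed
    qed (use z S in \<open>auto simp: dist_norm norm_minus_commute\<close>)
    then show "norm (f z - f a - ?D a (z - a)) \<le> C * ?r\<^sup>2"
      using lin[OF S(2)] by (simp add: linear_simps power2_eq_square algebra_simps)
  qed (rule e)
qed

section \<open>Tracing a transported quantity back along a straight line\<close>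

lemma bounded_linear_real_pair:
  fixes D :: "real \<times> real \<Rightarrow> 'a::real_normed_vector"
  assumes "bounded_linear D"
  shows "D (h, k) = h *\<^sub>R D (1, 0) + k *\<^sub>R D (0, 1)"
proof -
  interpret bounded_linear D by fact
  show ?thesis
    using add[of "(h, 0)" "(0, k)"] scaleR[of h "(1, 0)"] scaleR[of k "(0, 1)"] by simp
qed

text \<open>
  Turns the equation, which is stated with partial derivatives that are one-sided in time, into a relation
  between values of the total derivative, to which the chain rule along slanted lines applies.
\<close>
lemma transport_frechet_derivative:
  assumes D: "(q has_derivative D) (at (t, x) within {0..<T} \<times> UNIV)"
    and sol: "solves_transport T c q" and t: "t \<in> {0..<T}"
  shows "D (1, 0) = - c (t, x) * D (0, 1)"
proof -
  note D_eq = bounded_linear_real_pair[OF has_derivative_bounded_linear[OF D]]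
  obtain qt qx where qt: "((\<lambda>s. q (s, x)) has_real_derivative qt) (at t within {0..<T})"
    and qx: "((\<lambda>y. q (t, y)) has_real_derivative qx) (at x)"
    and eq: "qt + c (t, x) * qx = 0"
    using sol t unfolding solves_transport_def by blast
  have "((\<lambda>s. q (s, x)) has_derivative (\<lambda>h. D (h, 0))) (at t within {0..<T})"
  proof (rule has_derivative_in_compose[where f = "\<lambda>s. (s, x)" and g' = D])
    show "((\<lambda>s. (s, x)) has_derivative (\<lambda>h. (h, 0))) (at t within {0..<T})"
      by (intro has_derivative_Pair has_derivative_ident has_derivative_const)
    show "(q has_derivative D) (at (t, x) within (\<lambda>s. (s, x)) ` {0..<T})"
      by (rule has_derivative_subset[OF D]) auto
  qed
  moreover have "(\<lambda>h. D (h, 0)) = (*) (D (1, 0))"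
    by (rule ext) (subst D_eq, simp)
  ultimately have "((\<lambda>s. q (s, x)) has_real_derivative D (1, 0)) (at t within {0..<T})"
    by (simp add: has_field_derivative_def)
  moreover have "at t within {0..<T} \<noteq> bot"
    using t by (simp add: trivial_limit_within)
  ultimately have dt: "D (1, 0) = qt"
    using has_field_derivative_unique[OF _ qt] by blast
  have "((\<lambda>y. q (t, y)) has_derivative (\<lambda>h. D (0, h))) (at x)"
  proof (rule has_derivative_in_compose[where f = "\<lambda>y. (t, y)" and g' = D])
    show "((\<lambda>y. (t, y)) has_derivative (\<lambda>h. (0, h))) (at x)"
      by (intro has_derivative_Pair has_derivative_ident has_derivative_const)
    show "(q has_derivative D) (at (t, x) within range (Pair t))"
      by (rule has_derivative_subset[OF D]) (use t in auto)
  qed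
  moreover have "(\<lambda>h. D (0, h)) = (*) (D (0, 1))"
    by (rule ext) (subst D_eq, simp)
  ultimately have "((\<lambda>y. q (t, y)) has_real_derivative D (0, 1)) (at x)"
    by (simp add: has_field_derivative_def)
  then have "D (0, 1) = qx" using qx by (rule DERIV_unique)
  then show ?thesis using dt eq by simp
qed

text \<open>
  The slope \<open>A (1, - c a) / 2\<close> of \<open>w\<close> makes the mean of the speed error along the segment vanish to first
  order. The proof compares \<open>q\<close> along the segment with the quadratic polynomial in \<open>s\<close> whose derivative is
  the remaining error of first order, \<open>K b (t/2 - s)\<close>. This polynomial vanishes at both ends, and the derivative of
  the difference is \<open>O(t\<^sup>2)\<close> on an interval of length \<open>t\<close>.
\<close>
lemma transport_straight_line_order_3:
  fixes q c :: "real \<times> real \<Rightarrow> real" and w :: "real \<Rightarrow> real" and x T :: real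
  defines "S \<equiv> {0..<T} \<times> UNIV" and "a \<equiv> (0, x)"
  assumes T: "0 < T" and Ck: "Ck_on (Suc (Suc 0)) S q" and sol: "solves_transport T c q"
    and c: "has_quadratic_expansion c A a S"
    and w: "has_quadratic_expansion w (\<lambda>h. h * (A (1, - c a) / 2)) 0 UNIV" and w0: "w 0 = c a"
  shows "(\<lambda>t. q (0, x - t * w t) - q (t, x)) \<in> O[at_right 0](\<lambda>t. t ^ 3)"
proof -
  note A_eq = bounded_linear_real_pair[OF has_quadratic_expansion_bounded_linear[OF c]]
  define D where "D z = frechet_derivative q (at z within S)" for z
  define \<kappa> where "\<kappa> = A (1, - c a) / 2"
  define K where "K = A (1, 0) + c a * A (0, 1)"
  define b where "b = D a (0, 1)"
  have D: "(q has_derivative D z) (at z within S)" if "z \<in> S" for z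
    using Ck that unfolding D_def by (simp add: differentiable_on_def frechet_derivative_works)
  have "(\<lambda>z. D z (0, 1)) differentiable (at a within S)"
    using Ck T by (auto simp: D_def differentiable_on_def S_def a_def)
  then obtain Mq dq where Mq: "0 < Mq" and dq: "0 < dq" and
    qx: "\<And>z. z \<in> S \<Longrightarrow> norm (z - a) < dq \<Longrightarrow> norm (D z (0, 1) - b) \<le> Mq * norm (z - a)"
    unfolding b_def using differentiable_imp_locally_Lipschitz_at by metis
  obtain Cc dc where Cc: "0 \<le> Cc" and dc: "0 < dc" and
    c_bd: "\<And>z. z \<in> S \<Longrightarrow> norm (z - a) < dc \<Longrightarrow> norm (c z - c a - A (z - a)) \<le> Cc * (norm (z - a))\<^sup>2"
    using has_quadratic_expansionE[OF c] by metis
  obtain Cw dw where Cw: "0 \<le> Cw" and dw: "0 < dw" "dw \<le> 1" and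
    w_bd: "\<And>t. norm t < dw \<Longrightarrow> norm (w t - c a - t * \<kappa>) \<le> Cw * (norm t)\<^sup>2"
    using has_quadratic_expansionE[OF w] w0 unfolding \<kappa>_def by (metis UNIV_I diff_zero)
  \<comment> \<open>For \<open>0 < t < \<delta>\<close>, \<open>M\<close> bounds the speed \<open>w t\<close>, and \<open>M * t\<close> bounds the distance from the segment to \<open>a\<close>.\<close>
  define M where "M = \<bar>c a\<bar> + \<bar>\<kappa>\<bar> + Cw + 1"
  have M: "1 \<le> M" unfolding M_def using Cw by simp
  \<comment> \<open>\<open>F * t\<^sup>2\<close> bounds the second-order part of the speed error, \<open>E * t\<^sup>2\<close> that of the derivative of \<open>q\<close>
     along the segment.\<close>
  define F where "F = Cw + Cc * M\<^sup>2 + (\<bar>\<kappa>\<bar> + Cw) * \<bar>A (0, 1)\<bar>"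
  define E where "E = F * (\<bar>b\<bar> + Mq * M) + \<bar>K\<bar> * (Mq * M)"
  define \<delta> where "\<delta> = Min {T, dw, dc / M, dq / M}"
  have \<delta>: "0 < \<delta>" using T dw dc dq M by (simp add: \<delta>_def)
  have main: "\<bar>q (0, x - t * w t) - q (t, x)\<bar> \<le> E * t ^ 3" if t: "0 < t" "t < \<delta>" for t
  proof -
    have t': "t < T" "t < dw" "t < 1" "M * t < dc" "M * t < dq"
      using t dw M by (auto simp: \<delta>_def field_simps)
    have t2: "t\<^sup>2 \<le> t" using t t' by (simp add: power2_eq_square mult_left_le)
    have e1: "\<bar>w t - c a - t * \<kappa>\<bar> \<le> Cw * t\<^sup>2" using w_bd[of t] t t' by simp
    have wc: "\<bar>w t - c a\<bar> \<le> (\<bar>\<kappa>\<bar> + Cw) * t"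
    proof -
      have "\<bar>w t - c a\<bar> \<le> \<bar>t * \<kappa>\<bar> + \<bar>w t - c a - t * \<kappa>\<bar>" by linarith
      also have "\<dots> \<le> t * \<bar>\<kappa>\<bar> + Cw * t"
        using e1 mult_left_mono[OF t2 Cw] t by (simp add: abs_mult)
      finally show ?thesis by (simp add: algebra_simps)
    qed
    have "(\<bar>\<kappa>\<bar> + Cw) * t \<le> \<bar>\<kappa>\<bar> + Cw" using t t' Cw by (intro mult_left_le) auto
    then have wM: "\<bar>w t\<bar> \<le> M" using wc unfolding M_def by linarith
    define Z where "Z s = (s, x - w t * (t - s))" for s
    have Z_S: "Z s \<in> S" if "s \<in> {0..t}" for s using that t' by (simp add: Z_def S_def)
    have Z_a: "norm (Z s - a) \<le> M * t" if s: "s \<in> {0..t}" for s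
    proof -
      have "norm (Z s - a) \<le> \<bar>s\<bar> + \<bar>w t * (t - s)\<bar>"
        unfolding Z_def a_def using norm_Pair_le[of s "- (w t * (t - s))"] by simp
      also have "\<dots> \<le> M * s + M * (t - s)"
        using s M wM by (intro add_mono) (auto simp: abs_mult intro: mult_right_mono mult_right_mono[of 1 M s, simplified])
      finally show ?thesis by (simp add: algebra_simps)
    qed
    have deriv: "((\<lambda>s. q (Z s)) has_real_derivative (w t - c (Z s)) * D (Z s) (0, 1)) (at s within {0..t})"
      if s: "s \<in> {0..t}" for s
    proof -
      have eq: "D (Z s) (h, w t * h) = (w t - c (Z s)) * D (Z s) (0, 1) * h" for h
      proof -
        have "D (Z s) (1, 0) = - c (Z s) * D (Z s) (0, 1)"
          using transport_frechet_derivative[of q "D (Z s)" s "x - w t * (t - s)" T c] D[OF Z_S[OF s]] sol s t'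
          by (simp add: Z_def S_def)
        then show ?thesis
          using bounded_linear_real_pair[OF has_derivative_bounded_linear[OF D[OF Z_S[OF s]]], of h "w t * h"]
          by (simp add: algebra_simps)
      qed
      have "((\<lambda>s. q (Z s)) has_derivative (\<lambda>h. D (Z s) (h, w t * h))) (at s within {0..t})"
      proof (rule has_derivative_in_compose[where g' = "D (Z s)"])
        show "(Z has_derivative (\<lambda>h. (h, w t * h))) (at s within {0..t})"
          unfolding Z_def by (auto intro!: derivative_eq_intros)
        show "(q has_derivative D (Z s)) (at (Z s) within Z ` {0..t})"
          using D[OF Z_S[OF s]] Z_S by (auto intro: has_derivative_subset)
      qed
      then show ?thesis unfolding eq has_field_derivative_def .
    qed
    have bd: "\<bar>(w t - c (Z s)) * D (Z s) (0, 1) - K * b * (t / 2 - s)\<bar> \<le> E * t\<^sup>2" if s: "s \<in> {0..t}" for s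
    proof -
      have ts: "\<bar>t - s\<bar> \<le> t" "\<bar>t / 2 - s\<bar> \<le> t" using s by auto
      have "\<bar>c (Z s) - c a - A (Z s - a)\<bar> \<le> Cc * (norm (Z s - a))\<^sup>2"
        using c_bd[OF Z_S[OF s]] Z_a[OF s] t' by simp
      also have "\<dots> \<le> Cc * (M * t)\<^sup>2" using Z_a[OF s] Cc by (intro mult_left_mono power_mono) auto
      finally have e2: "\<bar>c (Z s) - c a - A (Z s - a)\<bar> \<le> Cc * M\<^sup>2 * t\<^sup>2"
        by (simp add: power_mult_distrib)
      have "\<bar>(w t - c a) * (t - s) * A (0, 1)\<bar> \<le> (\<bar>\<kappa>\<bar> + Cw) * t * t * \<bar>A (0, 1)\<bar>"
        unfolding abs_mult using wc ts t Cw by (intro mult_right_mono mult_mono) auto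
      then have e3: "\<bar>(w t - c a) * (t - s) * A (0, 1)\<bar> \<le> (\<bar>\<kappa>\<bar> + Cw) * \<bar>A (0, 1)\<bar> * t\<^sup>2"
        by (simp add: power2_eq_square mult_ac)
      \<comment> \<open>An exact identity: the linear terms recombine into \<open>K * (t / 2 - s)\<close> by the choice of \<open>\<kappa>\<close>.\<close>
      have "w t - c (Z s) - K * (t / 2 - s)
          = (w t - c a - t * \<kappa>) - (c (Z s) - c a - A (Z s - a)) + (w t - c a) * (t - s) * A (0, 1)"
        unfolding K_def \<kappa>_def Z_def a_def
        by (simp add: A_eq[of s] A_eq[of 1 "- c (0, x)"]) (simp add: field_simps)
      then have F: "\<bar>w t - c (Z s) - K * (t / 2 - s)\<bar> \<le> F * t\<^sup>2"
        using e1 e2 e3 unfolding F_def distrib_right by linarith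
      have qb: "\<bar>D (Z s) (0, 1) - b\<bar> \<le> Mq * M * t"
        using qx[OF Z_S[OF s] le_less_trans[OF Z_a[OF s] t'(5)]] mult_left_mono[OF Z_a[OF s], of Mq] Mq
        unfolding real_norm_def mult.assoc by linarith
      also have "\<dots> \<le> Mq * M" using t t' Mq M by (intro mult_left_le) auto
      finally have qM: "\<bar>D (Z s) (0, 1)\<bar> \<le> \<bar>b\<bar> + Mq * M" by linarith
      have "\<bar>(w t - c (Z s) - K * (t / 2 - s)) * D (Z s) (0, 1)\<bar> \<le> F * t\<^sup>2 * (\<bar>b\<bar> + Mq * M)"
        unfolding abs_mult using F qM by (intro mult_mono) auto
      moreover have "\<bar>K * (t / 2 - s) * (D (Z s) (0, 1) - b)\<bar> \<le> \<bar>K\<bar> * t * (Mq * M * t)"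
        unfolding abs_mult using ts qb t by (intro mult_mono mult_nonneg_nonneg) auto
      moreover have "(w t - c (Z s)) * D (Z s) (0, 1) - K * b * (t / 2 - s)
          = (w t - c (Z s) - K * (t / 2 - s)) * D (Z s) (0, 1) + K * (t / 2 - s) * (D (Z s) (0, 1) - b)"
        by (simp add: algebra_simps)
      moreover have "E * t\<^sup>2 = F * t\<^sup>2 * (\<bar>b\<bar> + Mq * M) + \<bar>K\<bar> * t * (Mq * M * t)"
        unfolding E_def by (simp add: algebra_simps power2_eq_square)
      ultimately show ?thesis by linarith
    qed
    define h where "h s = q (Z s) - K * b * (t * s / 2 - s\<^sup>2 / 2)" for s
    have "norm (h 0 - h t) \<le> E * t\<^sup>2 * norm (0 - t)"
    proof (rule field_differentiable_bound[where S = "{0..t}"])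
      fix s assume s: "s \<in> {0..t}"
      show "(h has_field_derivative (w t - c (Z s)) * D (Z s) (0, 1) - K * b * (t / 2 - s)) (at s within {0..t})"
        unfolding h_def by (rule derivative_eq_intros deriv[OF s] refl | simp)+
      show "norm ((w t - c (Z s)) * D (Z s) (0, 1) - K * b * (t / 2 - s)) \<le> E * t\<^sup>2"
        using bd[OF s] by simp
    qed (use t in auto)
    moreover have "h 0 - h t = q (0, x - t * w t) - q (t, x)"
      by (simp add: h_def Z_def power2_eq_square mult.commute)
    moreover have "E * t\<^sup>2 * norm (0 - t) = E * t ^ 3"
    proof -
      have "norm (0 - t) = t" using t by simp
      then show ?thesis by (simp only: power2_eq_square power3_eq_cube mult.assoc)
    qed
    ultimately show ?thesis by (simp only: real_norm_def)
  qed
  have "\<forall>\<^sub>F t in at_right 0. t \<in> {0<..<\<delta>}"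
    using \<delta> by (intro eventually_at_right_real)
  then have "\<forall>\<^sub>F t in at_right 0. norm (q (0, x - t * w t) - q (t, x)) \<le> E * norm (t ^ 3)"
  proof eventually_elim
    case (elim t)
    then have "norm (t ^ 3) = t ^ 3" by simp
    then show ?case using main[of t] elim by (simp only: real_norm_def greaterThanLessThan_iff)
  qed
  then show ?thesis by (rule bigoI)
qed

section \<open>The predictor-corrector speed\<close>

text \<open>
  The speed is multiplied by the step, which vanishes at the base point, so its derivative does not contribute.
  Step and starting point vary jointly because the second Euler step starts from the first one's foot.
\<close>
lemma euler_foot_has_quadratic_expansion:
  assumes l: "has_quadratic_expansion l L (u x, v x) UNIV"
    and u: "has_quadratic_expansion u U x UNIV" and v: "has_quadratic_expansion v V x UNIV"
  shows "has_quadratic_expansion (\<lambda>p. euler_foot l u v (fst p) (snd p))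
    (\<lambda>h. snd h - fst h * l (u x, v x)) (0, x) UNIV"
proof -
  have fst: "has_quadratic_expansion fst fst p UNIV" and snd: "has_quadratic_expansion snd snd p UNIV"
    for p :: "real \<times> real"
    by (intro has_quadratic_expansion_linear bounded_linear_fst bounded_linear_snd)+
  have "has_quadratic_expansion (\<lambda>y. l (u y, v y)) (\<lambda>h. L (U h, V h)) x UNIV"
    using has_quadratic_expansion_compose[OF has_quadratic_expansion_Pair[OF u v], of l L UNIV] l by simp
  then have "has_quadratic_expansion (\<lambda>p. l (u (snd p), v (snd p))) (\<lambda>h. L (U (snd h), V (snd h))) (0 :: real, x) UNIV"
    using has_quadratic_expansion_compose[OF snd[of "(0, x)"], of "\<lambda>y. l (u y, v y)" "\<lambda>h. L (U h, V h)" UNIV] by simp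
  from has_quadratic_expansion_diff[OF snd has_quadratic_expansion_mult[OF fst this]]
  show ?thesis by (simp add: euler_foot_def)
qed

text \<open>
  To first order the two Euler steps add up: the shift for \<open>Q\<^sub>i\<close> is \<open>- h (\<lambda> + \<lambda>\<^sub>i)\<close>, with both speeds taken at the
  base point.
\<close>
lemma predicted_speed_has_quadratic_expansion:
  assumes l1: "has_quadratic_expansion l1 L1 (u x, v x) UNIV"
    and l2: "has_quadratic_expansion l2 L2 (u x, v x) UNIV"
    and l: "has_quadratic_expansion l L (u x, v x) UNIV"
    and u: "has_quadratic_expansion u U x UNIV" and v: "has_quadratic_expansion v V x UNIV"
  shows "has_quadratic_expansion (\<lambda>s. predicted_speed l1 l2 l u v s x)
    (\<lambda>h. L (U (- h * (l (u x, v x) + l1 (u x, v x))), V (- h * (l (u x, v x) + l2 (u x, v x))))) 0 UNIV"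
proof -
  let ?y = "\<lambda>s. euler_foot l u v s x"
  have id: "has_quadratic_expansion (\<lambda>s. s) (\<lambda>h. h) (0 :: real) UNIV"
    by (intro has_quadratic_expansion_linear bounded_linear_ident)
  have start: "has_quadratic_expansion (\<lambda>s. (s, x)) (\<lambda>h. (h, 0)) (0 :: real) UNIV"
    by (rule has_quadratic_expansion_Pair[OF id has_quadratic_expansion_const])
  have y0: "?y 0 = x" by (simp add: euler_foot_def)
  have "has_quadratic_expansion ?y (\<lambda>h. 0 - h * l (u x, v x)) 0 UNIV"
    using has_quadratic_expansion_compose[OF start euler_foot_has_quadratic_expansion[OF l u v]] by simp
  note foot = has_quadratic_expansion_Pair[OF id this]
  have second: "has_quadratic_expansion (\<lambda>s. g (euler_foot k u v s (?y s)))
      (\<lambda>h. G (- h * (l (u x, v x) + k (u x, v x)))) 0 UNIV"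
    if k: "has_quadratic_expansion k J (u x, v x) UNIV" and g: "has_quadratic_expansion g G x UNIV"
    for k J and g G :: "real \<Rightarrow> real"
  proof -
    have eq: "- h * (l (u x, v x) + k (u x, v x)) = 0 - h * l (u x, v x) - h * k (u x, v x)" for h
      by (simp add: algebra_simps)
    have foot0: "euler_foot k u v 0 (?y 0) = x" by (simp add: euler_foot_def)
    have "has_quadratic_expansion (\<lambda>s. euler_foot k u v s (?y s))
      (\<lambda>h. - h * (l (u x, v x) + k (u x, v x))) 0 UNIV"
      using has_quadratic_expansion_compose[OF foot, of "\<lambda>p. euler_foot k u v (fst p) (snd p)"
          "\<lambda>h. snd h - fst h * k (u x, v x)" UNIV]
        euler_foot_has_quadratic_expansion[OF k u v] unfolding eq by (simp add: y0)
    from has_quadratic_expansion_compose[OF this, of g G UNIV] g show ?thesis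
      by (simp add: foot0)
  qed
  have "has_quadratic_expansion l L
      (u (euler_foot l1 u v 0 (?y 0)), v (euler_foot l2 u v 0 (?y 0))) UNIV"
    using l by (simp add: euler_foot_def)
  from has_quadratic_expansion_compose[OF has_quadratic_expansion_Pair[OF second[OF l1 u] second[OF l2 v]] this]
  show ?thesis by (simp add: predicted_speed_def Let_def)
qed

text \<open>
  Stated for a general family \<open>(l, q)\<close>, so that both components of the system are instances. The initial data are
  read off from the solution itself, which puts their expansions and those of \<open>Q1\<close>, \<open>Q2\<close> in terms of the same
  derivatives \<open>D1\<close>, \<open>D2\<close>.
\<close>
lemma corrected_foot_order_3:
  fixes l1 l2 l Q1 Q2 q :: "real \<times> real \<Rightarrow> real" and T \<alpha> x :: real
  defines "S \<equiv> {0..<T} \<times> UNIV"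
  assumes T: "0 < T" and \<alpha>: "\<alpha> \<noteq> 0"
    and l1: "Ck_on (Suc (Suc 0)) UNIV l1" and l2: "Ck_on (Suc (Suc 0)) UNIV l2"
    and l: "Ck_on (Suc (Suc 0)) UNIV l"
    and Q1: "Ck_on (Suc (Suc 0)) S Q1" and Q2: "Ck_on (Suc (Suc 0)) S Q2"
    and q: "Ck_on (Suc (Suc 0)) S q"
    and sol1: "solves_transport T (\<lambda>p. l1 (Q1 p, Q2 p)) Q1"
    and sol2: "solves_transport T (\<lambda>p. l2 (Q1 p, Q2 p)) Q2"
    and sol: "solves_transport T (\<lambda>p. l (Q1 p, Q2 p)) q"
  shows "(\<lambda>t. q (0, corrected_foot l1 l2 l (\<lambda>y. Q1 (0, y)) (\<lambda>y. Q2 (0, y)) \<alpha> t x) - q (t, x))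
    \<in> O[at_right 0](\<lambda>t. t ^ 3)"
proof -
  let ?a = "(0, x)" and ?u = "\<lambda>y. Q1 (0, y)" and ?v = "\<lambda>y. Q2 (0, y)"
  define p where "p = (Q1 ?a, Q2 ?a)"
  have S: "convex S" "?a \<in> S" using T by (auto simp: S_def intro: convex_Times)
  define D1 where "D1 = frechet_derivative Q1 (at ?a within S)"
  define D2 where "D2 = frechet_derivative Q2 (at ?a within S)"
  have e1: "has_quadratic_expansion Q1 D1 ?a S" and e2: "has_quadratic_expansion Q2 D2 ?a S"
    unfolding D1_def D2_def using Q1 Q2 S by (intro Ck_on_has_quadratic_expansion; simp)+
  have l_exp: "\<exists>L. has_quadratic_expansion k L p UNIV" if "Ck_on (Suc (Suc 0)) UNIV k"
    for k :: "real \<times> real \<Rightarrow> real"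
    using Ck_on_has_quadratic_expansion[OF that] by blast
  obtain L1 L2 L where L1: "has_quadratic_expansion l1 L1 p UNIV"
    and L2: "has_quadratic_expansion l2 L2 p UNIV" and L: "has_quadratic_expansion l L p UNIV"
    using l_exp[OF l1] l_exp[OF l2] l_exp[OF l] by blast
  interpret L: bounded_linear L using L by (rule has_quadratic_expansion_bounded_linear)
  note D1_eq = bounded_linear_real_pair[OF has_quadratic_expansion_bounded_linear[OF e1]]
    and D2_eq = bounded_linear_real_pair[OF has_quadratic_expansion_bounded_linear[OF e2]]
  have D1_t: "D1 (1, 0) = - l1 p * D1 (0, 1)"
    using transport_frechet_derivative[of Q1 D1 0 x T, OF _ sol1] Q1 T S
    by (simp add: S_def[symmetric] D1_def p_def differentiable_on_def frechet_derivative_works)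
  have D2_t: "D2 (1, 0) = - l2 p * D2 (0, 1)"
    using transport_frechet_derivative[of Q2 D2 0 x T, OF _ sol2] Q2 T S
    by (simp add: S_def[symmetric] D2_def p_def differentiable_on_def frechet_derivative_works)

  have line: "has_quadratic_expansion (\<lambda>y. (0, y)) (\<lambda>h. (0, h)) x UNIV"
    using T by (intro has_quadratic_expansion_Pair has_quadratic_expansion_const
        has_quadratic_expansion_linear bounded_linear_ident)
  have u: "has_quadratic_expansion ?u (\<lambda>h. D1 (0, h)) x UNIV"
    and v: "has_quadratic_expansion ?v (\<lambda>h. D2 (0, h)) x UNIV"
    using T by (auto intro!: has_quadratic_expansion_compose[OF line] e1 e2 simp: S_def)
  define A where "A h = L (D1 h, D2 h)" for h
  have c: "has_quadratic_expansion (\<lambda>z. l (Q1 z, Q2 z)) A ?a S"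
    unfolding A_def using has_quadratic_expansion_compose[OF has_quadratic_expansion_Pair[OF e1 e2], of l L UNIV] L
    by (simp add: p_def)
  \<comment> \<open>The transport equations turn the spatial shift \<open>- h * (l p + l1 p)\<close> into the space-time shift
     \<open>h * (1, - l p)\<close>, and similarly for the second component.\<close>
  have G: "has_quadratic_expansion (\<lambda>s. predicted_speed l1 l2 l ?u ?v s x) (\<lambda>h. h * A (1, - l p)) 0 UNIV"
  proof -
    have "D1 (0, - h * (l p + l1 p)) = h * D1 (1, - l p)" for h
      unfolding D1_eq[of 0 "- h * (l p + l1 p)"] D1_eq[of 1 "- l p"] D1_t by (simp add: algebra_simps)
    moreover have "D2 (0, - h * (l p + l2 p)) = h * D2 (1, - l p)" for h
      unfolding D2_eq[of 0 "- h * (l p + l2 p)"] D2_eq[of 1 "- l p"] D2_t by (simp add: algebra_simps)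
    moreover have "L (h * D1 (1, - l p), h * D2 (1, - l p)) = h * A (1, - l p)" for h
      using L.scaleR[of h "(D1 (1, - l p), D2 (1, - l p))"] by (simp add: A_def)
    ultimately show ?thesis
      using predicted_speed_has_quadratic_expansion[of l1 L1 ?u x ?v l2 L2 l L, OF _ _ _ u v] L1 L2 L
      by (simp add: p_def)
  qed
  define w where "w t = l p - (1 / (2 * \<alpha>)) * (l p - predicted_speed l1 l2 l ?u ?v (\<alpha> * t) x)" for t
  have "has_quadratic_expansion (\<lambda>t. \<alpha> * t) (\<lambda>h. \<alpha> * h) 0 UNIV"
    by (intro has_quadratic_expansion_linear bounded_linear_mult_right)
  from has_quadratic_expansion_compose[OF this, of _ _ UNIV] G
  have "has_quadratic_expansion (\<lambda>t. predicted_speed l1 l2 l ?u ?v (\<alpha> * t) x) (\<lambda>h. \<alpha> * h * A (1, - l p)) 0 UNIV"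
    by simp
  then have "has_quadratic_expansion w
      (\<lambda>h. 0 - (1 / (2 * \<alpha>) * (0 - \<alpha> * h * A (1, - l p)) + 0 * (l p - predicted_speed l1 l2 l ?u ?v (\<alpha> * 0) x))) 0 UNIV"
    unfolding w_def by (intro has_quadratic_expansion_diff has_quadratic_expansion_mult has_quadratic_expansion_const)
  then have w: "has_quadratic_expansion w (\<lambda>h. h * (A (1, - l p) / 2)) 0 UNIV"
    using \<alpha> by simp
  have "w 0 = l p" by (simp add: w_def predicted_speed_def euler_foot_def p_def)
  then have "(\<lambda>t. q (0, x - t * w t) - q (t, x)) \<in> O[at_right 0](\<lambda>t. t ^ 3)"
    using transport_straight_line_order_3[OF T, of q "\<lambda>z. l (Q1 z, Q2 z)" A x w] q sol c w
    by (simp add: S_def p_def)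
  moreover have "corrected_foot l1 l2 l ?u ?v \<alpha> t x = x - t * w t" for t
    by (simp add: corrected_foot_def w_def p_def algebra_simps)
  ultimately show ?thesis by simp
qed

theorem theorem4p2:
  fixes l1 l2 :: "real \<times> real \<Rightarrow> real"
    and Q10 Q20 :: "real \<Rightarrow> real"
    and Q1 Q2 :: "real \<times> real \<Rightarrow> real"
    and T \<alpha> x :: real
  assumes "smooth_on UNIV l1" and "smooth_on UNIV l2"
    and "smooth_on UNIV Q10" and "smooth_on UNIV Q20"
    and "T > 0"
    and "smooth_diagonal_solution l1 l2 Q10 Q20 T Q1 Q2"
    and "0 < \<alpha>" and "\<alpha> \<le> 1"
  shows "(\<lambda>t. Q10 (corrected_foot l1 l2 l1 Q10 Q20 \<alpha> t x) - Q1 (t, x)) \<in> O[at_right 0](\<lambda>t. t ^ 3) \<and>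
         (\<lambda>t. Q20 (corrected_foot l1 l2 l2 Q10 Q20 \<alpha> t x) - Q2 (t, x)) \<in> O[at_right 0](\<lambda>t. t ^ 3)"
proof -
  let ?S = "{0..<T} \<times> (UNIV :: real set)"
  have C2: "Ck_on (Suc (Suc 0)) M f" if "smooth_on M f" for M :: "(real \<times> real) set" and f :: "real \<times> real \<Rightarrow> real"
    using that by (simp only: smooth_on_def)
  have Q1: "Ck_on (Suc (Suc 0)) ?S Q1" and Q2: "Ck_on (Suc (Suc 0)) ?S Q2"
    and init: "Q10 = (\<lambda>y. Q1 (0, y))" "Q20 = (\<lambda>y. Q2 (0, y))"
    and sol1: "solves_transport T (\<lambda>p. l1 (Q1 p, Q2 p)) Q1"
    and sol2: "solves_transport T (\<lambda>p. l2 (Q1 p, Q2 p)) Q2"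
    using assms(6) C2 by (auto simp only: smooth_diagonal_solution_def fun_eq_iff)
  have \<alpha>: "\<alpha> \<noteq> 0" using assms(7) by simp
  note order_3 = corrected_foot_order_3[OF assms(5) \<alpha> C2[OF assms(1)] C2[OF assms(2)] _ Q1 Q2 _ sol1 sol2]
  show ?thesis
    unfolding init
    using order_3[OF C2[OF assms(1)] Q1 sol1] order_3[OF C2[OF assms(2)] Q2 sol2] by blast
qed

end
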